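(* Let $\varphi:\mathbb R\to\mathbb R$ be a continuous positive $1$-periodic function such that $N:=\int_0^1\varphi(t)\,dt$ is an integer $\ge2$ and $\varphi(x)>1$ for all $x$. Let $\sigma:\mathbb T\to\mathbb T$, $\sigma(e^{2\pi ix})=e^{2\pi i\int_0^x\varphi(t)\,dt}$, let $\psi(e^{2\pi ix})=1/\varphi(x)$, assume $\sum_{\sigma(w)=z}\psi(w)=1$ for all $z\in\mathbb T$, let $m\in C(\mathbb T)$ be a $\psi$-filter, and let $\mathfrak u(e^{2\pi ix})=m(e^{2\pi ix})/\sqrt{\varphi(x)}$. Let $r_k\in[0,1)$ satisfy $\int_0^{r_k}\varphi(t)\,dt=k$ for $k=1,\dots,N-1$, and let $r=\min\{r_1,1-r_{N-1}\}$. Assume that $|\mathfrak u(1)|=1$, that $\mathfrak u(e^{2\pi ix})\ne0$ if $|x|<r$, and that $\ln|\mathfrak u(e^{2\pi ix})|^2=O(x)$ for $x$ near $0$. For $x\in\mathbb R$ let $x_0=x$ and let $x_{n+1}$ be the real number with $\int_0^{x_{n+1}}\varphi(t)\,dt=x_n$ ($n\ge0$). Then the function $\tilde\phi:\mathbb R\to\mathbb C$ defined by $$\tilde\phi(x)=\prod_{n\ge1}\mathfrak u(e^{2\pi ix_n})=\prod_{n\ge1}\frac{m(e^{2\pi ix_n})}{\sqrt{\varphi(x_n)}}$$ is a unit vector in $L^2(\mathbb R)$ and $$\sum_{j\in\mathbb Z}|\tilde\phi(x+j)|^2=1\qquad\text{for all } x\in[-1/2,1/2).$$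
   Context: A $\psi$-filter is a function $m\in C(\mathbb T)$ (complex valued) with $\sum_{\sigma(w)=z}\psi(w)|m(w)|^2=1$ for all $z\in\mathbb T$.
   Formalization: The complex product need not converge (e.g. if u(1) = -1), so the claims for the complex-valued function are proved assuming the product converges at every x; for the product of the moduli |u|, convergence, unit L^2 norm and the sum identity are proved without this assumption. *)

theory Defs
  imports "HOL-Analysis.Analysis" "HOL-Library.Landau_Symbols"
begin

text \<open>The unit circle is \<^term>\<open>sphere (0::complex) 1\<close>, and the point with angle
  parameter \<open>x\<close> is \<^term>\<open>cis (2 * pi * x)\<close>.\<close>

text \<open>The interval integral is oriented, so this is negative for \<open>x < 0\<close> and positive \<open>\<phi>\<close>.\<close>

definition primitive :: "(real \<Rightarrow> real) \<Rightarrow> real \<Rightarrow> real" where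
  "primitive \<phi> x = (LBINT t=0..x. \<phi> t)"

text \<open>The sequence \<open>x\<^sub>0 = x\<close>, \<open>x\<^sub>1\<close>, \<open>x\<^sub>2\<close>, \<dots>; the description is proper
  because for continuous periodic positive \<open>\<phi>\<close> the primitive is a bijection of the reals.\<close>

primrec backward_orbit :: "(real \<Rightarrow> real) \<Rightarrow> real \<Rightarrow> nat \<Rightarrow> real" where
  "backward_orbit \<phi> x 0 = x"
| "backward_orbit \<phi> x (Suc n) = (THE y. primitive \<phi> y = backward_orbit \<phi> x n)"

definition psi_filter ::
    "(complex \<Rightarrow> complex) \<Rightarrow> (complex \<Rightarrow> real) \<Rightarrow> (complex \<Rightarrow> complex) \<Rightarrow> bool" where
  "psi_filter \<sigma> \<psi> m \<longleftrightarrow>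
     continuous_on (sphere 0 1) m \<and>
     (\<forall>z\<in>sphere 0 1. (\<Sum>w\<in>{w\<in>sphere 0 1. \<sigma> w = z}. \<psi> w * (cmod (m w))\<^sup>2) = 1)"

definition square_integrable :: "(real \<Rightarrow> 'a::real_normed_vector) \<Rightarrow> bool" where
  "square_integrable f \<longleftrightarrow>
     f \<in> borel_measurable lborel \<and> integrable lborel (\<lambda>x. (norm (f x))\<^sup>2)"

definition norm_L2 :: "(real \<Rightarrow> 'a::real_normed_vector) \<Rightarrow> real" where
  "norm_L2 f = sqrt (LBINT x. (norm (f x))\<^sup>2)"

text \<open>The product runs over \<open>x\<^sub>1\<close>, \<open>x\<^sub>2\<close>, \<dots>, without \<open>x\<^sub>0\<close>. It is generic in the
  codomain so that it applies both to a complex \<open>u\<close> and to its modulus.\<close>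

definition scaling_function ::
    "(real \<Rightarrow> real) \<Rightarrow> (complex \<Rightarrow> 'a::real_normed_field) \<Rightarrow> real \<Rightarrow> 'a" where
  "scaling_function \<phi> u x = (\<Prod>n. u (cis (2 * pi * backward_orbit \<phi> x (Suc n))))"

end

theory Submission imports Defs begin

text \<open>Write \<open>F\<close> for the primitive of \<open>\<phi>\<close>, \<open>G\<close> for its inverse and
  \<open>q x = \<bar>u (cis (2 * pi * x))\<bar>\<close>. Since \<open>F' = \<phi> > 1\<close> and \<open>\<phi>\<close> is bounded away from \<open>1\<close>, the map
  \<open>G\<close> is a contraction fixing \<open>0\<close>, and \<open>F (x + 1) = F x + N\<close> gives \<open>G (x + N) = G x + 1\<close>. The
  backward orbit of \<open>x\<close> is the sequence of iterates of \<open>G\<close>, and \<open>\<Phi> x\<close>, the modulus of the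
  scaling function, is the infinite product of \<open>q\<close> along it. It converges because the orbit
  tends to \<open>0\<close> geometrically and the logarithmic hypothesis makes \<open>\<bar>q x - 1\<bar>\<close> at most linear
  in \<open>\<bar>x\<bar>\<close> near \<open>0\<close>. The preimages of \<open>cis (2 * pi * x)\<close> under \<open>\<sigma>\<close> are the points with
  parameters \<open>G (x + k)\<close>, \<open>k < N\<close>, so the filter condition says that the squares of \<open>q\<close> at
  these parameters add up to \<open>1\<close>.

  Let \<open>P\<^sub>n\<close> be the product of the first \<open>n\<close> factors. It has period \<open>N ^ n\<close>, and iterating the
  filter condition shows that the sum of \<open>(P\<^sub>n (x + j))\<^sup>2\<close> over a complete system of residues
  \<open>j\<close> modulo \<open>N ^ n\<close> is \<open>1\<close> (\<open>partial_sum_residues\<close>). The theorem is the limit of this identity,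
  and the only difficulty is to exchange the limit with the sum. Fix \<open>a\<close> strictly between \<open>0\<close>
  and \<open>1\<close> and choose as residues those \<open>j\<close> for which the \<open>n\<close>-th iterate of \<open>x + j\<close> lies in the
  window \<open>[-a, 1 - a)\<close> (\<open>partial_sum_window\<close>). As \<open>0\<close> is an interior point of the window, every
  \<open>j\<close> is chosen for all large \<open>n\<close>. If \<open>\<Phi> \<ge> C > 0\<close> on the window, then
  \<open>\<Phi> y = P\<^sub>n y * \<Phi> (G\<^sup>n y)\<close> yields \<open>P\<^sub>n (x + j) \<le> \<Phi> (x + j) / C\<close> for the chosen \<open>j\<close>: up to a
  constant the limit itself dominates the approximations, and Fatou's argument makes it summable
  (\<open>has_sum_of_self_dominated_limit\<close>).

  Positivity of \<open>\<Phi>\<close> on a window is where the nonvanishing of \<open>u\<close> for \<open>\<bar>x\<bar> < r\<close> enters. One of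
  \<open>F r = 1\<close> and \<open>F (-r) = -1\<close> holds, so the interval \<open>(F (-r), F r)\<close> has length greater than \<open>1\<close>
  and contains some \<open>[-a, 1 - a]\<close> (\<open>window_exists\<close>). On it \<open>\<bar>G x\<bar> < r\<close>, and further iterates
  only come closer to \<open>0\<close>, so no factor of the product vanishes there.

  The unit norm follows by integrating the periodization identity over \<open>[0, 1)\<close>. For the complex
  scaling function everything is inherited from its modulus, except measurability, which comes
  from its being a pointwise limit of continuous functions.\<close>

section \<open>Limits of sums and periodization\<close>

text \<open>Dominated convergence in which the limit is its own majorant. Finite partial sums of \<open>g\<close>
  are limits of partial sums of \<open>f n\<close>, so they are at most \<open>s\<close>; this makes \<open>g\<close> summable, after
  which \<open>C * g\<close> controls the tails of \<open>f n\<close> uniformly in \<open>n\<close>.\<close>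

lemma has_sum_of_self_dominated_limit:
  fixes f :: "nat \<Rightarrow> 'a \<Rightarrow> real"
  assumes sum: "\<And>n. (f n has_sum s) UNIV"
    and lim: "\<And>j. (\<lambda>n. f n j) \<longlonglongrightarrow> g j"
    and nonneg: "\<And>n j. 0 \<le> f n j"
    and bound: "\<And>n j. f n j \<le> C * g j"
  shows "(g has_sum s) UNIV"
proof -
  have g_nonneg: "0 \<le> g j" for j
    using lim[of j] nonneg by (meson LIMSEQ_le_const)
  have finite_le: "sum g J \<le> s" if "finite J" for J
  proof (rule LIMSEQ_le_const2)
    show "(\<lambda>n. sum (f n) J) \<longlonglongrightarrow> sum g J"
      by (intro tendsto_sum lim)
    show "\<exists>N. \<forall>n\<ge>N. sum (f n) J \<le> s"
      using finite_sum_le_has_sum[OF sum that] nonneg by auto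
  qed
  have "g summable_on UNIV"
    by (rule nonneg_bdd_above_summable_on) (auto intro!: bdd_aboveI2 finite_le g_nonneg)
  then obtain S where S: "(g has_sum S) UNIV"
    by (auto simp: summable_on_def)
  have "S \<le> s"
    by (rule has_sum_le_finite_sums[OF S]) (use finite_le in auto)
  have ge: "s \<le> sum g J + C * (S - sum g J)" if J: "finite J" for J
  proof (rule LIMSEQ_le_const)
    show "(\<lambda>n. sum (f n) J + C * (S - sum g J)) \<longlonglongrightarrow> sum g J + C * (S - sum g J)"
      by (intro tendsto_intros lim)
    have "s - sum (f n) J \<le> C * (S - sum g J)" for n
    proof (rule has_sum_mono)
      show "(f n has_sum (s - sum (f n) J)) (UNIV - J)"
        by (intro has_sum_Diff sum has_sum_finite J) auto
      show "((\<lambda>j. C * g j) has_sum C * (S - sum g J)) (UNIV - J)"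
        by (intro has_sum_cmult_right has_sum_Diff S has_sum_finite J) auto
    qed (rule bound)
    then show "\<exists>N. \<forall>n\<ge>N. s \<le> sum (f n) J + C * (S - sum g J)"
      by (auto simp: algebra_simps)
  qed
  have "s \<le> S + C * (S - S)"
  proof (rule tendsto_lowerbound)
    show "((\<lambda>J. sum g J + C * (S - sum g J)) \<longlongrightarrow> S + C * (S - S)) (finite_subsets_at_top UNIV)"
      using S unfolding has_sum_def by (intro tendsto_intros)
    show "\<forall>\<^sub>F J in finite_subsets_at_top UNIV. s \<le> sum g J + C * (S - sum g J)"
      using ge by (auto simp: eventually_finite_subsets_at_top)
  qed simp
  then show ?thesis
    using S \<open>S \<le> s\<close> by simp
qed

lemma integral_of_periodization_one:
  fixes h :: "real \<Rightarrow> real"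
  assumes meas [measurable]: "h \<in> borel_measurable borel"
    and nonneg: "\<And>x. 0 \<le> h x"
    and period: "\<And>x. ((\<lambda>j::int. h (x + of_int j)) has_sum 1) UNIV"
  shows "integrable lborel h" "(LBINT x. h x) = 1"
proof -
  have fibre: "(\<integral>\<^sup>+j. ennreal (h (x + of_int j)) \<partial>count_space (UNIV :: int set)) = 1" for x
  proof -
    have "Infinite_Set_Sum.abs_summable_on (\<lambda>j::int. h (x + of_int j)) UNIV"
      using has_sum_imp_summable[OF period[of x]] nonneg
      by (simp flip: abs_summable_equivalent)
    then show ?thesis
      using period[of x] nonneg
      by (simp add: nn_integral_conv_infsetsum infsetsum_infsum has_sum_iff)
  qed
  have split: "ennreal (h x) = (\<integral>\<^sup>+j. ennreal (h x) * indicator {0..<1} (x - of_int j) \<partial>count_space (UNIV :: int set))" for x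
  proof -
    have "indicator {0..<1} (x - of_int j) = (indicator {\<lfloor>x\<rfloor>} j :: ennreal)" for j
      by (auto simp: indicator_def) linarith+
    then show ?thesis
      by (simp add: nn_integral_count_space_indicator nn_integral_cmult)
  qed
  \<comment> \<open>Cut the line into unit intervals, shift each to \<open>[0, 1)\<close> and sum inside the integral.\<close>
  have "(\<integral>\<^sup>+x. ennreal (h x) \<partial>lborel)
      = (\<integral>\<^sup>+x. (\<integral>\<^sup>+j. ennreal (h x) * indicator {0..<1} (x - of_int j) \<partial>count_space (UNIV :: int set)) \<partial>lborel)"
    by (rule nn_integral_cong) (rule split)
  also have "\<dots> = (\<integral>\<^sup>+j. (\<integral>\<^sup>+x. ennreal (h x) * indicator {0..<1} (x - of_int j) \<partial>lborel) \<partial>count_space (UNIV :: int set))"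
    by (rule nn_integral_count_space_nn_integral) auto
  also have "\<dots> = (\<integral>\<^sup>+j. (\<integral>\<^sup>+x. ennreal (h (x + of_int j)) * indicator {0..<1} x \<partial>lborel) \<partial>count_space (UNIV :: int set))"
  proof (rule nn_integral_cong)
    fix j :: int
    show "(\<integral>\<^sup>+x. ennreal (h x) * indicator {0..<1} (x - of_int j) \<partial>lborel)
        = (\<integral>\<^sup>+x. ennreal (h (x + of_int j)) * indicator {0..<1} x \<partial>lborel)"
      by (subst nn_integral_real_affine[where c = 1 and t = "of_int j"]) (auto simp: add.commute)
  qed
  also have "\<dots> = (\<integral>\<^sup>+x. (\<integral>\<^sup>+j. ennreal (h (x + of_int j)) * indicator {0..<1} x \<partial>count_space (UNIV :: int set)) \<partial>lborel)"
    by (rule nn_integral_count_space_nn_integral[symmetric]) auto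
  also have "\<dots> = (\<integral>\<^sup>+x. indicator {0..<1::real} x \<partial>lborel)"
    by (simp add: nn_integral_multc fibre)
  also have "\<dots> = 1"
    by simp
  finally have total: "(\<integral>\<^sup>+x. ennreal (h x) \<partial>lborel) = ennreal 1"
    by simp
  have "has_bochner_integral lborel h 1"
    by (rule has_bochner_integral_nn_integral) (use total nonneg in auto)
  then show "integrable lborel h" "(LBINT x. h x) = 1"
    by (auto simp: has_bochner_integral_iff)
qed

section \<open>Products along a contracting orbit\<close>

text \<open>For \<open>d = 0\<close> this is periodicity, as needed for \<open>\<phi>\<close> and \<open>q\<close>; the inverse of a lift of a
  circle map of degree \<open>N\<close> is the case \<open>c = N\<close>, \<open>d = 1\<close>.\<close>

lemma shift_int:
  fixes f :: "real \<Rightarrow> real"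
  assumes "\<And>x. f (x + c) = f x + d"
  shows "f (x + of_int i * c) = f x + of_int i * d"
proof (induction i rule: int_induct[where k = 0])
  case (step1 i)
  then show ?case
    using assms[of "x + of_int i * c"] by (simp add: algebra_simps)
next
  case (step2 i)
  then show ?case
    using assms[of "x + of_int (i - 1) * c"] by (simp add: algebra_simps)
qed simp

text \<open>The abstract setting for the product along a backward orbit. \<open>G\<close> plays the role of the
  inverse of the primitive and \<open>q\<close> that of the modulus of the filter, both lifted to the line.
  The numbers \<open>\<delta>\<close> and \<open>M\<close> bound \<open>q - 1\<close> linearly near the fixed point, which is what makes the
  product converge; the window \<open>[-a, 1 - a]\<close> has length \<open>1\<close>, so up to an end point it is a
  fundamental domain for integer translations; it has \<open>0\<close> in its interior, and no factor vanishes
  along the orbits that start in it.\<close>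

locale cascade =
  fixes G q :: "real \<Rightarrow> real" and N :: nat and \<kappa> \<delta> M a :: real
  assumes G_cont: "continuous_on UNIV G"
    and G_contracts: "\<And>x. \<bar>G x\<bar> \<le> \<kappa> * \<bar>x\<bar>"
    and \<kappa>: "0 \<le> \<kappa>" "\<kappa> < 1"
    and G_shift: "\<And>x. G (x + real N) = G x + 1"
    and q_cont: "continuous_on UNIV q"
    and q_periodic: "\<And>x. q (x + 1) = q x"
    and q_nonneg: "\<And>x. 0 \<le> q x"
    and q_filter: "\<And>x. (\<Sum>k<N. (q (G (x + real k)))\<^sup>2) = 1"
    and \<delta>: "0 < \<delta>"
    and M: "0 \<le> M"
    and q_near_0: "\<And>x. \<bar>x\<bar> < \<delta> \<Longrightarrow> \<bar>q x - 1\<bar> \<le> M * \<bar>x\<bar>"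
    and a: "0 < a" "a < 1"
    and q_pos: "\<And>x n. x \<in> {-a..1 - a} \<Longrightarrow> 0 < q ((G ^^ Suc n) x)"
begin

definition partial_prod :: "nat \<Rightarrow> real \<Rightarrow> real" where
  "partial_prod n x = (\<Prod>k<n. q ((G ^^ Suc k) x))"

definition limit_prod :: "real \<Rightarrow> real" where
  "limit_prod x = (\<Prod>n. q ((G ^^ Suc n) x))"

lemma N_pos: "0 < N"
  using q_filter[of 0] by (cases N) auto

lemma iterate_cont: "continuous_on UNIV (G ^^ n)"
proof (induction n)
  case (Suc n)
  then show ?case
    using continuous_on_compose[OF Suc continuous_on_subset[OF G_cont]] by simp
qed simp

lemma iterate_contracts: "\<bar>(G ^^ n) x\<bar> \<le> \<kappa> ^ n * \<bar>x\<bar>"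
proof (induction n)
  case (Suc n)
  have "\<bar>(G ^^ Suc n) x\<bar> \<le> \<kappa> * \<bar>(G ^^ n) x\<bar>"
    using G_contracts by simp
  also have "\<dots> \<le> \<kappa> * (\<kappa> ^ n * \<bar>x\<bar>)"
    using Suc \<kappa> by (intro mult_left_mono)
  finally show ?case by (simp add: mult.assoc)
qed simp

lemma iterate_tendsto_0: "(\<lambda>n. (G ^^ n) x) \<longlonglongrightarrow> 0"
proof (rule Lim_null_comparison)
  show "\<forall>\<^sub>F n in sequentially. norm ((G ^^ n) x) \<le> \<kappa> ^ n * \<bar>x\<bar>"
    using iterate_contracts by auto
  show "(\<lambda>n. \<kappa> ^ n * \<bar>x\<bar>) \<longlonglongrightarrow> 0"
    using \<kappa> by (intro tendsto_mult_left_zero LIMSEQ_realpow_zero)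
qed

lemma q_shift_int: "q (x + of_int i) = q x"
  using shift_int[of q 1 0 x i] q_periodic by simp

lemma iterate_shift_int: "(G ^^ n) (x + of_int i * real N ^ n) = (G ^^ n) x + of_int i"
proof (induction n arbitrary: i)
  case (Suc n)
  have "(G ^^ Suc n) (x + of_int i * real N ^ Suc n)
      = G ((G ^^ n) (x + of_int (i * int N) * real N ^ n))"
    by (simp add: algebra_simps)
  also have "\<dots> = G ((G ^^ n) x + of_int i * real N)"
    by (subst Suc) simp
  also have "\<dots> = (G ^^ Suc n) x + of_int i"
    using shift_int[of G "real N" 1] G_shift by simp
  finally show ?case .
qed simp

lemma partial_nonneg: "0 \<le> partial_prod n x"
  by (simp add: partial_prod_def prod_nonneg q_nonneg)

lemma partial_cont: "continuous_on UNIV (partial_prod n)"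
  unfolding partial_prod_def
  by (intro continuous_on_prod continuous_on_compose2[OF q_cont iterate_cont]) auto

lemma partial_shift_int: "partial_prod n (x + of_int i * real N ^ n) = partial_prod n x"
  unfolding partial_prod_def
proof (rule prod.cong)
  fix k assume "k \<in> {..<n}"
  then have n: "real N ^ n = real N ^ (n - Suc k) * real N ^ Suc k"
    by (simp flip: power_add del: power_Suc)
  have "(G ^^ Suc k) (x + of_int i * real N ^ n)
      = (G ^^ Suc k) (x + of_int (i * int N ^ (n - Suc k)) * real N ^ Suc k)"
    unfolding n by (simp add: mult.assoc)
  also have "\<dots> = (G ^^ Suc k) x + of_int (i * int N ^ (n - Suc k))"
    by (rule iterate_shift_int)
  finally show "q ((G ^^ Suc k) (x + of_int i * real N ^ n)) = q ((G ^^ Suc k) x)"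
    by (simp only: q_shift_int)
qed simp

lemma partial_Suc: "partial_prod (Suc n) x = q (G x) * partial_prod n (G x)"
  unfolding partial_prod_def by (subst prod.lessThan_Suc_shift) (simp add: funpow_swap1)

text \<open>The residues modulo \<open>N ^ Suc n\<close> are \<open>i + k * N\<close> with \<open>i < N\<close> and \<open>k < N ^ n\<close>, and \<open>G\<close> sends
  \<open>x + i + k * N\<close> to \<open>G (x + i) + k\<close>. By periodicity of \<open>q\<close> the first factor depends on \<open>i\<close> only;
  the remaining factors sum over \<open>k\<close> to \<open>1\<close> by induction, and the first factors then sum over
  \<open>i\<close> to \<open>1\<close> by the filter condition.\<close>

lemma partial_sum_residues: "(\<Sum>j<N ^ n. (partial_prod n (x + real j))\<^sup>2) = 1"
proof (induction n arbitrary: x)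
  case 0
  then show ?case by (simp add: partial_prod_def lessThan_Suc)
next
  case (Suc n)
  have step: "(partial_prod (Suc n) (x + real (i + k * N)))\<^sup>2
      = (q (G (x + real i)))\<^sup>2 * (partial_prod n (G (x + real i) + real k))\<^sup>2" for i k
  proof -
    have G: "G (x + real (i + k * N)) = G (x + real i) + real k"
      using shift_int[of G "real N" 1 "x + real i" "int k"] G_shift by (simp add: algebra_simps)
    have "q (G (x + real i) + real k) = q (G (x + real i))"
      using q_shift_int[of _ "int k"] by simp
    with G show ?thesis
      by (simp add: partial_Suc power_mult_distrib)
  qed
  have "(\<Sum>j<N ^ Suc n. (partial_prod (Suc n) (x + real j))\<^sup>2)
      = (\<Sum>k<N ^ n. \<Sum>j = k * N..<k * N + N. (partial_prod (Suc n) (x + real j))\<^sup>2)"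
    by (subst sum.nat_group) (simp add: mult.commute)
  also have "\<dots> = (\<Sum>k<N ^ n. \<Sum>i<N. (partial_prod (Suc n) (x + real (i + k * N)))\<^sup>2)"
  proof (rule sum.cong)
    fix k
    show "(\<Sum>j = k * N..<k * N + N. (partial_prod (Suc n) (x + real j))\<^sup>2)
        = (\<Sum>i<N. (partial_prod (Suc n) (x + real (i + k * N)))\<^sup>2)"
      using sum.shift_bounds_nat_ivl[of "\<lambda>j. (partial_prod (Suc n) (x + real j))\<^sup>2" 0 "k * N" N]
      by (simp add: add.commute atLeast0LessThan)
  qed simp
  also have "\<dots> = (\<Sum>i<N. \<Sum>k<N ^ n. (q (G (x + real i)))\<^sup>2 * (partial_prod n (G (x + real i) + real k))\<^sup>2)"
    by (subst sum.swap) (simp only: step)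
  also have "\<dots> = 1"
    by (simp add: Suc q_filter flip: sum_distrib_left)
  finally show ?case .
qed

definition window :: "nat \<Rightarrow> real \<Rightarrow> int set" where
  "window n x = {j. (G ^^ n) (x + of_int j) \<in> {-a..<1 - a}}"

text \<open>Adding a multiple \<open>l * N ^ n\<close> to \<open>j\<close> moves the \<open>n\<close>-th iterate of \<open>x + j\<close> by \<open>l\<close> and leaves
  \<open>partial_prod n\<close> unchanged. As \<open>[-a, 1 - a)\<close> has length \<open>1\<close>, \<open>window n x\<close> contains exactly one
  representative of every residue class modulo \<open>N ^ n\<close>.\<close>

lemma partial_sum_window:
  "((\<lambda>j. if j \<in> window n x then (partial_prod n (x + of_int j))\<^sup>2 else 0) has_sum 1) UNIV"
proof -
  \<comment> \<open>The representative of the class of \<open>i\<close> that lies in the window.\<close>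
  define rep where "rep i = int i - \<lfloor>(G ^^ n) (x + real i) + a\<rfloor> * int N ^ n" for i :: nat
  have iterate_rep: "(G ^^ n) (x + of_int (rep i)) = (G ^^ n) (x + real i) - \<lfloor>(G ^^ n) (x + real i) + a\<rfloor>" for i
    using iterate_shift_int[of n "x + real i" "- \<lfloor>(G ^^ n) (x + real i) + a\<rfloor>"]
    by (simp add: rep_def algebra_simps)
  have partial_rep: "partial_prod n (x + of_int (rep i)) = partial_prod n (x + real i)" for i
    using partial_shift_int[of n "x + real i" "- \<lfloor>(G ^^ n) (x + real i) + a\<rfloor>"]
    by (simp add: rep_def algebra_simps)
  have rep_mod: "rep i mod int (N ^ n) = int i" if "i < N ^ n" for i
  proof -
    have "rep i mod int (N ^ n) = int i mod int (N ^ n)"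
      by (simp add: rep_def mod_diff_eq[symmetric, of "int i" "_ * _"])
    then show ?thesis using that by simp
  qed
  have rep_of_mod: "rep (nat (j mod int (N ^ n))) = j" if "j \<in> window n x" for j
  proof -
    define i where "i = nat (j mod int (N ^ n))"
    define l where "l = j div int (N ^ n)"
    have i: "int i = j mod int (N ^ n)"
      unfolding i_def using N_pos by simp
    then have j: "j = int i + l * int N ^ n"
      by (simp only: l_def i mod_mult_div_eq of_nat_power[symmetric] mod_div_mult_eq)
    have "(G ^^ n) (x + of_int j) = (G ^^ n) (x + real i) + of_int l"
      using iterate_shift_int[of n "x + real i" l] by (simp add: j algebra_simps)
    with that have "\<lfloor>(G ^^ n) (x + real i) + a\<rfloor> = - l"
      unfolding window_def by (auto simp: floor_eq_iff)
    then show ?thesis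
      unfolding rep_def i_def[symmetric] by (simp add: j)
  qed
  have "(\<Sum>j\<in>window n x. (partial_prod n (x + of_int j))\<^sup>2) = (\<Sum>i<N ^ n. (partial_prod n (x + real i))\<^sup>2)"
  proof (rule sum.reindex_bij_witness[where i = rep and j = "\<lambda>j. nat (j mod int (N ^ n))"])
    fix j assume "j \<in> window n x"
    then show "rep (nat (j mod int (N ^ n))) = j" by (rule rep_of_mod)
    then show "(partial_prod n (x + real (nat (j mod int (N ^ n)))))\<^sup>2 = (partial_prod n (x + of_int j))\<^sup>2"
      using partial_rep[of "nat (j mod int (N ^ n))"] by simp
    show "nat (j mod int (N ^ n)) \<in> {..<N ^ n}"
      using N_pos by (simp add: nat_less_iff)
  next
    fix i assume "i \<in> {..<N ^ n}"
    then show "nat (rep i mod int (N ^ n)) = i" using rep_mod[of i] by (simp del: of_nat_power)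
    show "rep i \<in> window n x"
      unfolding window_def using iterate_rep[of i] by simp linarith
  qed
  moreover have "finite (window n x)"
  proof (rule finite_subset)
    show "window n x \<subseteq> rep ` {..<N ^ n}"
    proof
      fix j assume "j \<in> window n x"
      then have "j = rep (nat (j mod int (N ^ n)))" by (rule rep_of_mod[symmetric])
      moreover have "nat (j mod int (N ^ n)) < N ^ n"
        using N_pos by (simp add: nat_less_iff)
      ultimately show "j \<in> rep ` {..<N ^ n}" by blast
    qed
  qed simp
  ultimately have "((\<lambda>j. (partial_prod n (x + of_int j))\<^sup>2) has_sum 1) (window n x)"
    using partial_sum_residues by (intro has_sum_finiteI) simp_all
  then show ?thesis
    by (rule has_sum_cong_neutral[THEN iffD1, rotated -1]) auto
qed

lemma summable_distances: "summable (\<lambda>n. M * \<bar>(G ^^ Suc n) x\<bar>)"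
proof (rule summable_comparison_test)
  show "summable (\<lambda>n. M * (\<kappa> ^ Suc n * \<bar>x\<bar>))"
    using \<kappa> by (intro summable_mult summable_mult2) (simp add: summable_mult)
  show "\<exists>n0. \<forall>n\<ge>n0. norm (M * \<bar>(G ^^ Suc n) x\<bar>) \<le> M * (\<kappa> ^ Suc n * \<bar>x\<bar>)"
    using M iterate_contracts by (auto simp: abs_mult simp del: funpow.simps power_Suc intro!: mult_left_mono)
qed

lemma convergent: "convergent_prod (\<lambda>n. q ((G ^^ Suc n) x))"
proof (rule abs_convergent_prod_imp_convergent_prod)
  have "\<forall>\<^sub>F n in sequentially. norm (norm (q ((G ^^ Suc n) x) - 1)) \<le> M * \<bar>(G ^^ Suc n) x\<bar>"
  proof -
    have "\<forall>\<^sub>F n in sequentially. \<bar>(G ^^ Suc n) x\<bar> < \<delta>"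
      using tendstoD[OF iterate_tendsto_0[THEN LIMSEQ_Suc] \<delta>] by (simp only: dist_norm real_norm_def diff_0_right)
    then show ?thesis
      by eventually_elim (simp add: q_near_0)
  qed
  then have "summable (\<lambda>n. norm (q ((G ^^ Suc n) x) - 1))"
    by (rule summable_comparison_test_ev) (rule summable_distances)
  then show "abs_convergent_prod (\<lambda>n. q ((G ^^ Suc n) x))"
    by (simp add: abs_convergent_prod_conv_summable)
qed

lemma partial_tendsto: "(\<lambda>n. partial_prod n x) \<longlonglongrightarrow> limit_prod x"
  unfolding partial_prod_def limit_prod_def
  using convergent_prod_LIMSEQ[OF convergent[of x]] by (simp add: LIMSEQ_lessThan_iff_atMost)

lemma limit_measurable: "limit_prod \<in> borel_measurable borel"
  by (rule borel_measurable_LIMSEQ_metric[OF borel_measurable_continuous_onI[OF partial_cont] partial_tendsto])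

lemma partial_add: "partial_prod (k + n) x = partial_prod n x * partial_prod k ((G ^^ n) x)"
proof (induction n arbitrary: x)
  case 0
  then show ?case by (simp add: partial_prod_def)
next
  case (Suc n)
  then show ?case by (simp add: partial_Suc funpow_swap1)
qed

lemma limit_split: "limit_prod x = partial_prod n x * limit_prod ((G ^^ n) x)"
proof (rule LIMSEQ_unique)
  show "(\<lambda>k. partial_prod (k + n) x) \<longlonglongrightarrow> limit_prod x"
    using partial_tendsto by (rule LIMSEQ_ignore_initial_segment)
  show "(\<lambda>k. partial_prod (k + n) x) \<longlonglongrightarrow> partial_prod n x * limit_prod ((G ^^ n) x)"
    unfolding partial_add by (intro tendsto_intros partial_tendsto)
qed

text \<open>Near \<open>0\<close> the factors are at least \<open>1 - M * \<bar>y\<bar> * \<kappa> ^ k\<close>, so by Weierstrass' inequality the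
  product is at least \<open>1\<close> minus a geometric sum, which is at most \<open>1 / 2\<close> for small \<open>y\<close>.\<close>

lemma limit_ge_half_near_0: "\<exists>e>0. \<forall>y. \<bar>y\<bar> < e \<longrightarrow> 1 / 2 \<le> limit_prod y"
proof -
  \<comment> \<open>The bound makes \<open>M * \<bar>y\<bar> / (1 - \<kappa>) \<le> 1 / 2\<close>; the summand \<open>1\<close> only avoids division by \<open>0\<close>.\<close>
  define e where "e = min \<delta> ((1 - \<kappa>) / (2 * (M + 1)))"
  have "0 < e"
    using \<delta> \<kappa> M by (simp add: e_def)
  moreover have "1 / 2 \<le> limit_prod y" if y: "\<bar>y\<bar> < e" for y
  proof (rule LIMSEQ_le_const[OF partial_tendsto], intro exI allI impI)
    fix n :: nat
    have My: "(M + 1) * \<bar>y\<bar> \<le> (1 - \<kappa>) / 2"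
      using y M by (simp add: e_def field_simps)
    have small: "\<bar>(G ^^ Suc k) y\<bar> \<le> \<kappa> ^ k * \<bar>y\<bar>" for k
    proof -
      have "\<kappa> ^ Suc k * \<bar>y\<bar> \<le> \<kappa> ^ k * \<bar>y\<bar>"
        using \<kappa> by (intro mult_right_mono power_decreasing) auto
      with iterate_contracts[of "Suc k" y] show ?thesis
        by (rule order_trans)
    qed
    have "\<kappa> ^ k * \<bar>y\<bar> \<le> \<bar>y\<bar>" for k
      using \<kappa> by (simp add: mult_left_le_one_le power_le_one)
    then have "\<bar>(G ^^ Suc k) y\<bar> < \<delta>" for k
      using small[of k] y unfolding e_def
      by (meson le_less_trans min_less_iff_conj)
    then have "\<bar>q ((G ^^ Suc k) y) - 1\<bar> \<le> M * \<bar>(G ^^ Suc k) y\<bar>" for k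
      by (rule q_near_0)
    then have lower: "1 - M * \<bar>y\<bar> * \<kappa> ^ k \<le> q ((G ^^ Suc k) y)" for k
    proof -
      have "M * \<bar>(G ^^ Suc k) y\<bar> \<le> M * \<bar>y\<bar> * \<kappa> ^ k"
        using mult_left_mono[OF small M, of k] by (simp only: ac_simps)
      moreover have "\<bar>q ((G ^^ Suc k) y) - 1\<bar> \<le> M * \<bar>(G ^^ Suc k) y\<bar>"
        by fact
      ultimately show ?thesis by linarith
    qed
    have "M * \<bar>y\<bar> \<le> (1 - \<kappa>) / 2"
      using My by (simp add: algebra_simps)
    then have t1: "M * \<bar>y\<bar> * \<kappa> ^ k \<le> 1" for k
      using \<kappa> M mult_le_one[of "M * \<bar>y\<bar>" "\<kappa> ^ k"] by (simp add: power_le_one)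
    have "(\<Sum>k<n. M * \<bar>y\<bar> * \<kappa> ^ k) = M * \<bar>y\<bar> * (\<Sum>k<n. \<kappa> ^ k)"
      by (simp add: sum_distrib_left)
    also have "\<dots> \<le> (1 - \<kappa>) / 2 * (\<Sum>k<n. \<kappa> ^ k)"
      using \<open>M * \<bar>y\<bar> \<le> (1 - \<kappa>) / 2\<close> \<kappa> by (intro mult_right_mono sum_nonneg) auto
    also have "\<dots> \<le> 1 / 2"
      using one_diff_power_eq[of \<kappa> n] zero_le_power[OF \<kappa>(1), of n] by simp
    finally have "1 / 2 \<le> 1 - (\<Sum>k<n. M * \<bar>y\<bar> * \<kappa> ^ k)"
      by simp
    also have "\<dots> \<le> (\<Prod>k<n. 1 - M * \<bar>y\<bar> * \<kappa> ^ k)"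
      using t1 M \<kappa> by (intro Weierstrass_prod_ineq) auto
    also have "\<dots> \<le> partial_prod n y"
      unfolding partial_prod_def using t1 lower by (intro prod_mono) auto
    finally show "1 / 2 \<le> partial_prod n y" .
  qed
  ultimately show ?thesis by blast
qed

text \<open>After finitely many steps, uniformly on the window, the orbit is so close to \<open>0\<close> that the
  rest of the product is at least \<open>1 / 2\<close>. The initial factors form a continuous positive function
  on a compact interval, which attains its positive minimum.\<close>

lemma limit_bounded_below: "\<exists>C>0. \<forall>x\<in>{-a..1 - a}. C \<le> limit_prod x"
proof -
  obtain e where e: "0 < e" "\<And>y. \<bar>y\<bar> < e \<Longrightarrow> 1 / 2 \<le> limit_prod y"
    using limit_ge_half_near_0 by blast
  obtain n where n: "\<kappa> ^ n < e"
    using real_arch_pow_inv[OF e(1) \<kappa>(2)] by blast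
  have "compact {-a..1 - a}" "{-a..1 - a} \<noteq> {}"
    by auto
  then obtain x0 where x0: "x0 \<in> {-a..1 - a}" "\<And>x. x \<in> {-a..1 - a} \<Longrightarrow> partial_prod n x0 \<le> partial_prod n x"
    using continuous_attains_inf[OF _ _ continuous_on_subset[OF partial_cont]] by (metis subset_UNIV)
  have "partial_prod n x0 / 2 \<le> limit_prod x" if x: "x \<in> {-a..1 - a}" for x
  proof -
    have "\<bar>x\<bar> \<le> 1"
      using x a by auto
    then have "\<bar>(G ^^ n) x\<bar> \<le> \<kappa> ^ n * 1"
      using \<kappa> by (intro order_trans[OF iterate_contracts] mult_left_mono) auto
    with n have "1 / 2 \<le> limit_prod ((G ^^ n) x)"
      by (intro e) simp
    then have "partial_prod n x0 * (1 / 2) \<le> partial_prod n x * limit_prod ((G ^^ n) x)"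
      using x0(2)[OF x] partial_nonneg by (intro mult_mono) auto
    then show ?thesis
      by (simp add: limit_split[of x n])
  qed
  moreover have "0 < partial_prod n x0"
    unfolding partial_prod_def using q_pos[OF x0(1)] by (simp add: prod_pos del: funpow.simps)
  ultimately show ?thesis
    by (intro exI[of _ "partial_prod n x0 / 2"]) auto
qed

text \<open>On the window \<open>limit_prod\<close> is at least some \<open>C > 0\<close>, so \<open>limit_split\<close> bounds the summands of
  \<open>partial_sum_window\<close> by \<open>1 / C\<^sup>2\<close> times those of the limit. Each \<open>j\<close> is eventually in
  \<open>window n x\<close> because the orbit of \<open>x + j\<close> tends to the interior point \<open>0\<close>.\<close>

lemma limit_periodization: "((\<lambda>j::int. (limit_prod (x + of_int j))\<^sup>2) has_sum 1) UNIV"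
proof -
  obtain C where C: "0 < C" "\<And>y. y \<in> {-a..1 - a} \<Longrightarrow> C \<le> limit_prod y"
    using limit_bounded_below by blast
  show ?thesis
  proof (rule has_sum_of_self_dominated_limit)
    fix n
    show "((\<lambda>j. if j \<in> window n x then (partial_prod n (x + of_int j))\<^sup>2 else 0) has_sum 1) UNIV"
      by (rule partial_sum_window)
  next
    fix j
    have "\<forall>\<^sub>F n in sequentially. (G ^^ n) (x + of_int j) \<in> {-a<..<1 - a}"
      using a by (intro topological_tendstoD[OF iterate_tendsto_0]) auto
    then have "\<forall>\<^sub>F n in sequentially. (partial_prod n (x + of_int j))\<^sup>2
        = (if j \<in> window n x then (partial_prod n (x + of_int j))\<^sup>2 else 0)"
      by eventually_elim (auto simp: window_def)
    then show "(\<lambda>n. if j \<in> window n x then (partial_prod n (x + of_int j))\<^sup>2 else 0)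
        \<longlonglongrightarrow> (limit_prod (x + of_int j))\<^sup>2"
      by (rule Lim_transform_eventually[rotated]) (intro tendsto_intros partial_tendsto)
  next
    fix n j
    show "(if j \<in> window n x then (partial_prod n (x + of_int j))\<^sup>2 else 0)
        \<le> (1 / C\<^sup>2) * (limit_prod (x + of_int j))\<^sup>2"
    proof (cases "j \<in> window n x")
      case True
      then have "C \<le> limit_prod ((G ^^ n) (x + of_int j))"
        by (intro C) (auto simp: window_def)
      then have "partial_prod n (x + of_int j) * C \<le> limit_prod (x + of_int j)"
        using limit_split[of "x + of_int j" n] partial_nonneg by (simp add: mult_left_mono)
      then have "(partial_prod n (x + of_int j) * C)\<^sup>2 \<le> (limit_prod (x + of_int j))\<^sup>2"
        using C partial_nonneg by (intro power_mono) auto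
      with True C show ?thesis
        by (simp add: field_simps)
    qed simp
  qed auto
qed

lemma limit_square_integrable: "integrable lborel (\<lambda>x. (limit_prod x)\<^sup>2)"
  and limit_unit_norm: "(LBINT x. (limit_prod x)\<^sup>2) = 1"
proof -
  have "(\<lambda>x. (limit_prod x)\<^sup>2) \<in> borel_measurable borel"
    using limit_measurable by measurable
  from integral_of_periodization_one[OF this _ limit_periodization]
  show "integrable lborel (\<lambda>x. (limit_prod x)\<^sup>2)" "(LBINT x. (limit_prod x)\<^sup>2) = 1"
    by simp_all
qed

end

section \<open>The inverse of the primitive\<close>

lemma cis_2pi_eq_iff: "cis (2 * pi * s) = cis (2 * pi * t) \<longleftrightarrow> (\<exists>i::int. s = t + of_int i)"
proof -
  have "cis (2 * pi * s) = cis (2 * pi * t) \<longleftrightarrow> (\<exists>i::int. 2 * pi * s = 2 * pi * t + 2 * pi * of_int i)"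
    using sin_cos_eq_iff[of "2 * pi * s" "2 * pi * t"] by (auto simp: complex_eq_iff)
  also have "\<dots> \<longleftrightarrow> (\<exists>i::int. s = t + of_int i)"
    by (simp flip: distrib_left)
  finally show ?thesis .
qed

lemma sphere_eq_cis_2pi:
  assumes "w \<in> sphere 0 1"
  obtains t where "w = cis (2 * pi * t)"
proof
  show "w = cis (2 * pi * (Arg w / (2 * pi)))"
    using assms rcis_cmod_Arg[of w] by (simp add: rcis_def)
qed

locale expanding_lift =
  fixes \<phi> :: "real \<Rightarrow> real" and N :: nat
  assumes \<phi>_cont: "continuous_on UNIV \<phi>"
    and \<phi>_gt_1: "\<And>x. 1 < \<phi> x"
    and \<phi>_periodic: "\<And>x. \<phi> (x + 1) = \<phi> x"
    and \<phi>_mass: "(LBINT t=0..1. \<phi> t) = real N"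
begin

abbreviation F :: "real \<Rightarrow> real" where "F \<equiv> primitive \<phi>"

definition G :: "real \<Rightarrow> real" where "G = inv F"

lemma primitive_0: "F 0 = 0"
  by (simp add: primitive_def zero_ereal_def)

lemma primitive_1: "F 1 = real N"
  using \<phi>_mass by (simp add: primitive_def one_ereal_def)

lemma primitive_deriv: "(F has_real_derivative \<phi> x) (at x)"
proof -
  define b where "b = \<bar>x\<bar> + 1"
  have "((\<lambda>u. LBINT t=ereal 0..u. \<phi> t) has_vector_derivative \<phi> x) (at x within {-b..b})"
    by (rule interval_integral_FTC2) (auto simp: b_def intro: continuous_on_subset[OF \<phi>_cont])
  moreover have "at x within {-b..b} = at x"
    by (rule at_within_Icc_at) (auto simp: b_def)
  ultimately show ?thesis
    by (simp add: has_real_derivative_iff_has_vector_derivative primitive_def[abs_def] zero_ereal_def)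
qed

lemma primitive_cont: "continuous_on UNIV F"
  by (rule DERIV_continuous_on) (rule has_field_derivative_at_within[OF primitive_deriv])

lemma primitive_shift: "F (x + 1) = F x + real N"
proof -
  have "((\<lambda>x. F (x + 1) - F x) has_real_derivative 0) (at x)" for x
  proof -
    have "((\<lambda>x. F (x + 1)) has_real_derivative \<phi> (x + 1)) (at x)"
      using primitive_deriv[of "x + 1"] by (simp add: DERIV_shift)
    from DERIV_diff[OF this primitive_deriv] show ?thesis
      by (simp add: \<phi>_periodic)
  qed
  then have "F (x + 1) - F x = F (0 + 1) - F 0"
    by (intro DERIV_isconst_all) blast
  then show ?thesis
    by (simp add: primitive_0 primitive_1)
qed

text \<open>Pointwise \<open>\<phi> > 1\<close> becomes a uniform bound because, by periodicity, all values are attained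
  on the compact interval \<open>[0, 1]\<close>. Without uniformity \<open>G\<close> would not be a strict contraction.\<close>

lemma density_bounded_below: "\<exists>c>1. \<forall>x. c \<le> \<phi> x"
proof -
  have "\<exists>t\<in>{0..1}. \<forall>y\<in>{0..1}. \<phi> t \<le> \<phi> y"
    by (rule continuous_attains_inf) (auto intro: continuous_on_subset[OF \<phi>_cont])
  then obtain t where t: "\<And>y. y \<in> {0..1} \<Longrightarrow> \<phi> t \<le> \<phi> y"
    by blast
  have "\<phi> t \<le> \<phi> x" for x
  proof -
    have "\<phi> (frac x) = \<phi> x"
      using shift_int[of \<phi> 1 0 "frac x" "\<lfloor>x\<rfloor>"] \<phi>_periodic by (simp add: frac_def)
    then show ?thesis
      using t[of "frac x"] by (simp add: frac_lt_1 less_imp_le)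
  qed
  with \<phi>_gt_1 show ?thesis by blast
qed

lemma primitive_mvt:
  assumes "x < y"
  shows "\<exists>z. F y - F x = (y - x) * \<phi> z"
  using MVT2[OF assms primitive_deriv] by blast

lemma primitive_expands: "\<exists>c>1. \<forall>x y. c * \<bar>x - y\<bar> \<le> \<bar>F x - F y\<bar>"
proof -
  obtain c where c: "1 < c" "\<And>x. c \<le> \<phi> x"
    using density_bounded_below by blast
  have lt: "c * (y - x) \<le> F y - F x" if "x < y" for x y
  proof -
    obtain z where "F y - F x = (y - x) * \<phi> z"
      using primitive_mvt[OF \<open>x < y\<close>] by blast
    then show ?thesis
      using c(2)[of z] that by (simp add: mult.commute)
  qed
  have "c * \<bar>x - y\<bar> \<le> \<bar>F x - F y\<bar>" for x y
    using lt[of x y] lt[of y x] by (cases x y rule: linorder_cases) auto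
  with c(1) show ?thesis by blast
qed

lemma primitive_strict_mono: "strict_mono F"
proof (rule strict_monoI)
  fix x y :: real assume "x < y"
  then obtain z where "F y - F x = (y - x) * \<phi> z"
    using primitive_mvt by blast
  moreover have "0 < (y - x) * \<phi> z"
    using \<open>x < y\<close> \<phi>_gt_1[of z] by simp
  ultimately show "F x < F y" by simp
qed

lemma primitive_surj: "surj F"
proof -
  have ge: "y - x \<le> F y - F x" if "x < y" for x y
  proof -
    obtain z where "F y - F x = (y - x) * \<phi> z"
      using primitive_mvt[OF \<open>x < y\<close>] by blast
    then show ?thesis
      using \<phi>_gt_1[of z] that by simp
  qed
  have "\<exists>x. F x = y" for y
  proof -
    define b where "b = \<bar>y\<bar> + 1"
    have "F (- b) \<le> y" "y \<le> F b"
      using ge[of "- b" 0] ge[of 0 b] unfolding b_def primitive_0 by linarith+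
    then show ?thesis
      using IVT'[of F "- b" y b] continuous_on_subset[OF primitive_cont subset_UNIV]
      by (auto simp: b_def)
  qed
  then show ?thesis unfolding surj_def by metis
qed

lemma F_G [simp]: "F (G y) = y"
  unfolding G_def by (rule surj_f_inv_f[OF primitive_surj])

lemma G_F [simp]: "G (F x) = x"
  unfolding G_def by (rule inv_f_f[OF strict_mono_imp_inj_on[OF primitive_strict_mono]])

lemma G_less_iff: "G x < y \<longleftrightarrow> x < F y" "y < G x \<longleftrightarrow> F y < x"
  using strict_mono_less[OF primitive_strict_mono, of "G x" y]
    strict_mono_less[OF primitive_strict_mono, of y "G x"] by simp_all

lemma G_shift: "G (x + real N) = G x + 1"
  using G_F[of "G x + 1"] unfolding primitive_shift by simp

lemma G_lipschitz: "\<exists>\<kappa>. 0 \<le> \<kappa> \<and> \<kappa> < 1 \<and> (\<forall>x y. \<bar>G x - G y\<bar> \<le> \<kappa> * \<bar>x - y\<bar>)"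
proof -
  obtain c where c: "1 < c" "\<And>x y. c * \<bar>x - y\<bar> \<le> \<bar>F x - F y\<bar>"
    using primitive_expands by blast
  have "\<bar>G x - G y\<bar> \<le> (1 / c) * \<bar>x - y\<bar>" for x y
    using c(1) c(2)[of "G x" "G y"] by (simp add: field_simps)
  with c(1) show ?thesis
    by (intro exI[of _ "1 / c"]) simp
qed

lemma G_0: "G 0 = 0"
  using G_F[of 0] by (simp add: primitive_0)

lemma G_cont: "continuous_on UNIV G"
proof -
  obtain \<kappa> where "0 \<le> \<kappa>" "\<And>x y. \<bar>G x - G y\<bar> \<le> \<kappa> * \<bar>x - y\<bar>"
    using G_lipschitz by blast
  then have "\<kappa>-lipschitz_on UNIV G"
    by (auto simp: lipschitz_on_def dist_real_def)
  then show ?thesis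
    by (rule lipschitz_on_continuous_on)
qed

lemma backward_orbit_eq: "backward_orbit \<phi> x n = (G ^^ n) x"
proof (induction n)
  case (Suc n)
  have "(THE y. F y = (G ^^ n) x) = G ((G ^^ n) x)"
    by (rule the_equality) (simp, metis G_F)
  with Suc show ?case by simp
qed simp

text \<open>A parameter \<open>t\<close> gives a preimage iff \<open>F t = x + i\<close> for an integer \<open>i\<close>. Writing
  \<open>i = k + l * N\<close> with \<open>k < N\<close> gives \<open>t = G (x + k) + l\<close>, and \<open>l\<close> is invisible on the circle.\<close>

lemma fibre:
  assumes \<sigma>: "\<And>x. \<sigma> (cis (2 * pi * x)) = cis (2 * pi * F x)" and N: "0 < N"
  shows "{w \<in> sphere 0 1. \<sigma> w = cis (2 * pi * x)} = (\<lambda>k. cis (2 * pi * G (x + real k))) ` {..<N}"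
    (is "?L = ?R")
proof
  show "?R \<subseteq> ?L"
  proof
    fix w assume "w \<in> ?R"
    then obtain k where w: "w = cis (2 * pi * G (x + real k))"
      by blast
    have "\<sigma> w = cis (2 * pi * (x + real k))"
      unfolding w \<sigma> by simp
    also have "\<dots> = cis (2 * pi * x)"
      unfolding cis_2pi_eq_iff by (rule exI[of _ "int k"]) simp
    finally show "w \<in> ?L" by (simp add: w)
  qed
  show "?L \<subseteq> ?R"
  proof
    fix w assume w: "w \<in> ?L"
    then obtain t where t: "w = cis (2 * pi * t)"
      using sphere_eq_cis_2pi by blast
    with w \<sigma> obtain i :: int where i: "F t = x + of_int i"
      by (auto simp: cis_2pi_eq_iff)
    define k where "k = nat (i mod int N)"
    have k: "int k = i mod int N" "k < N"
      using N by (auto simp: k_def nat_less_iff)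
    have "i = int k + (i div int N) * int N"
      by (simp only: k mod_div_mult_eq)
    then have "real_of_int i = of_int (int k + (i div int N) * int N)"
      by (rule arg_cong)
    also have "\<dots> = real k + of_int (i div int N) * real N"
      by (simp only: of_int_add of_int_mult of_int_of_nat_eq)
    finally have "real_of_int i = real k + of_int (i div int N) * real N" .
    then have "t = G (x + real k + of_int (i div int N) * real N)"
      using i G_F[of t] by (simp add: add.assoc)
    also have "\<dots> = G (x + real k) + of_int (i div int N)"
      using shift_int[of G "real N" 1] G_shift by simp
    finally have "w = cis (2 * pi * G (x + real k))"
      unfolding t cis_2pi_eq_iff by blast
    with k(2) show "w \<in> ?R" by blast
  qed
qed

lemma fibre_inj: "inj_on (\<lambda>k. cis (2 * pi * G (x + real k))) {..<N}"
proof (rule inj_onI)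
  fix k l assume kl: "k \<in> {..<N}" "l \<in> {..<N}"
    and "cis (2 * pi * G (x + real k)) = cis (2 * pi * G (x + real l))"
  then obtain i :: int where "G (x + real k) = G (x + real l) + of_int i"
    by (auto simp: cis_2pi_eq_iff)
  also have "\<dots> = G (x + real l + of_int i * real N)"
    using shift_int[of G "real N" 1] G_shift by simp
  finally have "x + real k = x + real l + of_int i * real N"
    using F_G by metis
  then have "real_of_int (int k) = real_of_int (int l + i * int N)"
    by simp
  then have "int k = int l + i * int N"
    by (simp only: of_int_eq_iff)
  then have "int k mod int N = int l mod int N"
    by simp
  with kl show "k = l" by simp
qed

lemma backward_orbit_cont: "continuous_on UNIV (\<lambda>x. backward_orbit \<phi> x n)"
proof (induction n)
  case (Suc n)
  then show ?case
    using continuous_on_compose2[OF G_cont Suc] by (simp only: backward_orbit_eq funpow.simps o_apply) simp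
qed simp

lemma scaling_function_measurable:
  fixes u :: "complex \<Rightarrow> 'a::real_normed_field"
  assumes cont: "continuous_on UNIV (\<lambda>x. u (cis (2 * pi * x)))"
    and conv: "\<And>x. convergent_prod (\<lambda>n. u (cis (2 * pi * backward_orbit \<phi> x (Suc n))))"
  shows "scaling_function \<phi> u \<in> borel_measurable borel"
proof (rule borel_measurable_LIMSEQ_metric)
  show "(\<lambda>n. \<Prod>k\<le>n. u (cis (2 * pi * backward_orbit \<phi> x (Suc k)))) \<longlonglongrightarrow> scaling_function \<phi> u x" for x
    unfolding scaling_function_def by (rule convergent_prod_LIMSEQ[OF conv])
  show "(\<lambda>x. \<Prod>k\<le>n. u (cis (2 * pi * backward_orbit \<phi> x (Suc k)))) \<in> borel_measurable borel" for n
    by (intro borel_measurable_continuous_onI continuous_on_prod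
        continuous_on_compose2[OF cont backward_orbit_cont]) auto
qed

text \<open>The condition on the window is \<open>F (-r) < -a\<close> and \<open>1 - a < F r\<close> for \<open>r = min s (1 - t)\<close>. Here
  \<open>F s = 1\<close> and \<open>F (t - 1) = -1\<close>, so one of the two endpoints \<open>F r\<close>, \<open>F (-r)\<close> is exactly \<open>1\<close> or
  \<open>-1\<close> while the other is a nonzero number of its own sign; hence the interval between them is
  longer than \<open>1\<close>, and a suitable \<open>a\<close> exists.\<close>

lemma window_exists:
  assumes s: "F s = 1" and t: "F t = real N - 1" "t < 1"
  shows "\<exists>a. 0 < a \<and> a < 1 \<and> (\<forall>x\<in>{-a..1 - a}. \<bar>G x\<bar> < min s (1 - t))"
proof -
  define r where "r = min s (1 - t)"
  have F_t: "F (- (1 - t)) = - 1"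
    using primitive_shift[of "t - 1"] t(1) by simp
  have "0 < s"
    using strict_mono_less[OF primitive_strict_mono, of 0 s] s by (simp add: primitive_0)
  then have "0 < r"
    using t by (simp add: r_def)
  then have F_r: "0 < F r" "F (- r) < 0"
    using strict_mono_less[OF primitive_strict_mono, of 0 r]
      strict_mono_less[OF primitive_strict_mono, of "- r" 0] by (simp_all add: primitive_0)
  have "max 0 (1 - F r) < min 1 (- F (- r))"
  proof (cases "r = s")
    case True
    with F_r s show ?thesis by simp
  next
    case False
    then have "r = 1 - t"
      unfolding r_def by linarith
    then have "F (- r) = - 1"
      using F_t by simp
    with F_r show ?thesis by simp
  qed
  then obtain a where "max 0 (1 - F r) < a" "a < min 1 (- F (- r))"
    using dense by blast
  then have a: "0 < a" "1 - a < F r" "a < 1" "F (- r) < - a"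
    by auto
  have "\<bar>G x\<bar> < r" if "x \<in> {-a..1 - a}" for x
  proof -
    have "G x < r" "- r < G x"
      unfolding G_less_iff using that a by auto
    then show ?thesis by linarith
  qed
  with a show ?thesis
    unfolding r_def by blast
qed

end

section \<open>The scaling function\<close>

theorem theorem13p6p2:
  fixes \<phi> :: "real \<Rightarrow> real" and N :: nat
    and \<sigma> m u :: "complex \<Rightarrow> complex" and \<psi> :: "complex \<Rightarrow> real"
    and rk :: "nat \<Rightarrow> real" and r :: real
  assumes "continuous_on UNIV \<phi>"
    and "\<And>x. \<phi> x > 0"
    and "\<And>x. \<phi> (x + 1) = \<phi> x"
    and "(LBINT t=0..1. \<phi> t) = real N"
    and "N \<ge> 2"
    and "\<And>x. \<phi> x > 1"
    and "\<And>x. \<sigma> (cis (2 * pi * x)) = cis (2 * pi * primitive \<phi> x)"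
    and "\<And>x. \<psi> (cis (2 * pi * x)) = 1 / \<phi> x"
    and "\<And>z. z \<in> sphere 0 1 \<Longrightarrow> (\<Sum>w\<in>{w\<in>sphere 0 1. \<sigma> w = z}. \<psi> w) = 1"
    and "psi_filter \<sigma> \<psi> m"
    and "\<And>x. u (cis (2 * pi * x)) = m (cis (2 * pi * x)) / of_real (sqrt (\<phi> x))"
    and "\<And>k. k \<in> {1..N - 1} \<Longrightarrow> rk k \<in> {0..<1} \<and> primitive \<phi> (rk k) = real k"
    and "r = min (rk 1) (1 - rk (N - 1))"
    and "cmod (u 1) = 1"
    and "\<And>x. \<bar>x\<bar> < r \<Longrightarrow> u (cis (2 * pi * x)) \<noteq> 0"
    and "(\<lambda>x. ln ((cmod (u (cis (2 * pi * x))))\<^sup>2)) \<in> O[at 0](\<lambda>x. x)"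
  shows
    "(\<forall>x. convergent_prod (\<lambda>n. cmod (u (cis (2 * pi * backward_orbit \<phi> x (Suc n)))))) \<and>
     (let \<Phi> = scaling_function \<phi> (\<lambda>z. cmod (u z)) in
        square_integrable \<Phi> \<and> norm_L2 \<Phi> = 1 \<and>
        (\<forall>x\<in>{-1/2..<1/2}. ((\<lambda>j::int. (\<Phi> (x + of_int j))\<^sup>2) has_sum 1) UNIV)) \<and>
     ((\<forall>x. convergent_prod (\<lambda>n. u (cis (2 * pi * backward_orbit \<phi> x (Suc n))))) \<longrightarrow>
      (let \<Phi> = scaling_function \<phi> u in
        (\<forall>x. \<Phi> x = (\<Prod>n. m (cis (2 * pi * backward_orbit \<phi> x (Suc n))) /
                              of_real (sqrt (\<phi> (backward_orbit \<phi> x (Suc n)))))) \<and>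
        square_integrable \<Phi> \<and> norm_L2 \<Phi> = 1 \<and>
        (\<forall>x\<in>{-1/2..<1/2}. ((\<lambda>j::int. (cmod (\<Phi> (x + of_int j)))\<^sup>2) has_sum 1) UNIV)))"
proof -
  interpret expanding_lift \<phi> N
    by unfold_locales (use assms in auto)
  note \<sigma> = assms(7) and \<psi> = assms(8) and m = assms(10) and u = assms(11) and rk = assms(12)
  define q where "q x = cmod (u (cis (2 * pi * x)))" for x
  have N: "0 < N" using assms(5) by simp

  have u_cont: "continuous_on UNIV (\<lambda>x. u (cis (2 * pi * x)))"
  proof -
    have "continuous_on UNIV (\<lambda>x. m (cis (2 * pi * x)))"
    proof (rule continuous_on_compose2[of "sphere 0 1" m UNIV "\<lambda>x. cis (2 * pi * x)"])
      show "continuous_on (sphere 0 1) m"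
        using m by (simp add: psi_filter_def)
      show "continuous_on UNIV (\<lambda>x. cis (2 * pi * x))"
        by (intro continuous_intros)
    qed auto
    then show ?thesis
      unfolding u using assms(2)
      by (intro continuous_intros \<phi>_cont) (simp_all add: less_imp_neq[symmetric])
  qed
  have q_cont: "continuous_on UNIV q"
    unfolding q_def by (intro continuous_on_norm u_cont)
  have q_periodic: "q (x + 1) = q x" for x
  proof -
    have "cis (2 * pi * (x + 1)) = cis (2 * pi * x)"
      unfolding cis_2pi_eq_iff by (rule exI[of _ 1]) simp
    then show ?thesis by (simp add: q_def)
  qed
  have q_filter: "(\<Sum>k<N. (q (G (x + real k)))\<^sup>2) = 1" for x
  proof -
    have weight: "\<psi> (cis (2 * pi * y)) * (cmod (m (cis (2 * pi * y))))\<^sup>2 = (q y)\<^sup>2" for y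
      using \<phi>_gt_1[of y] by (simp add: q_def u \<psi> norm_divide power_divide)
    have "1 = (\<Sum>w\<in>{w\<in>sphere 0 1. \<sigma> w = cis (2 * pi * x)}. \<psi> w * (cmod (m w))\<^sup>2)"
      using m unfolding psi_filter_def by simp
    also have "\<dots> = (\<Sum>k<N. (q (G (x + real k)))\<^sup>2)"
      unfolding fibre[OF \<sigma> N] sum.reindex[OF fibre_inj] by (simp add: weight)
    finally show ?thesis by simp
  qed
  have q_le_1: "q x \<le> 1" for x
  proof -
    have "(q (G (F x + real 0)))\<^sup>2 \<le> (\<Sum>k<N. (q (G (F x + real k)))\<^sup>2)"
      using N by (intro member_le_sum) auto
    then show ?thesis
      unfolding q_filter by (simp add: q_def power_le_one_iff abs_square_le_1)
  qed
  have q_0: "q 0 = 1"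
    using assms(14) by (simp add: q_def)
  \<comment> \<open>Since \<open>q \<le> 1\<close>, the bound on \<open>ln (q\<^sup>2)\<close> passes to \<open>1 - q\<close> through \<open>1 - q \<le> - ln q\<close>.\<close>
  obtain M \<delta> where M: "0 \<le> M" and \<delta>: "0 < \<delta>"
    and q_near_0: "\<And>x. \<bar>x\<bar> < \<delta> \<Longrightarrow> \<bar>q x - 1\<bar> \<le> M * \<bar>x\<bar>"
  proof -
    obtain c where c: "0 < c" "\<forall>\<^sub>F x in at 0. norm (ln ((q x)\<^sup>2)) \<le> c * norm x"
      using landau_o.bigE[OF assms(16)] unfolding q_def by blast
    have "(q \<longlongrightarrow> q 0) (at 0)"
      using q_cont by (simp add: continuous_on_eq_continuous_at isCont_def)
    then have "\<forall>\<^sub>F x in at 0. 0 < q x"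
      by (rule order_tendstoD) (simp add: q_0)
    with c(2) have "\<forall>\<^sub>F x in at 0. \<bar>q x - 1\<bar> \<le> c * \<bar>x\<bar>"
    proof eventually_elim
      case (elim x)
      have "1 - q x \<le> - ln (q x)"
        using ln_le_minus_one[OF elim(2)] by simp
      also have "\<dots> \<le> \<bar>ln ((q x)\<^sup>2)\<bar>"
        using elim(2) q_le_1[of x] by (simp add: ln_realpow)
      also have "\<dots> \<le> c * \<bar>x\<bar>"
        using elim(1) by simp
      finally show ?case
        using q_le_1[of x] by simp
    qed
    then obtain d where "0 < d" "\<And>x. x \<noteq> 0 \<Longrightarrow> \<bar>x\<bar> < d \<Longrightarrow> \<bar>q x - 1\<bar> \<le> c * \<bar>x\<bar>"
      by (auto simp: eventually_at dist_real_def)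
    then show ?thesis
      using that[of c d] c(1) q_0 by (metis abs_zero diff_self less_imp_le mult_zero_right order_refl)
  qed

  obtain \<kappa> where \<kappa>: "0 \<le> \<kappa>" "\<kappa> < 1" and lipschitz: "\<And>x y. \<bar>G x - G y\<bar> \<le> \<kappa> * \<bar>x - y\<bar>"
    using G_lipschitz by blast
  have contracts: "\<bar>G x\<bar> \<le> \<kappa> * \<bar>x\<bar>" for x
    using lipschitz[of x 0] by (simp add: G_0)
  have shrinks: "\<bar>(G ^^ n) y\<bar> \<le> \<bar>y\<bar>" for n y
  proof (induction n)
    case (Suc n)
    have "\<bar>(G ^^ Suc n) y\<bar> \<le> \<kappa> * \<bar>(G ^^ n) y\<bar>"
      by (simp add: contracts)
    also have "\<dots> \<le> \<bar>(G ^^ n) y\<bar>"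
      using \<kappa> by (intro mult_left_le_one_le) auto
    finally show ?case using Suc by simp
  qed simp
  obtain a where a: "0 < a" "a < 1" and small: "\<And>x. x \<in> {-a..1 - a} \<Longrightarrow> \<bar>G x\<bar> < r"
  proof -
    have "F (rk 1) = 1" "F (rk (N - 1)) = real N - 1" "rk (N - 1) < 1"
      using rk[of 1] rk[of "N - 1"] assms(5) by (auto simp: of_nat_diff)
    from window_exists[OF this] show ?thesis
      using that unfolding assms(13) by blast
  qed
  have q_pos: "0 < q ((G ^^ Suc n) x)" if "x \<in> {-a..1 - a}" for x n
  proof -
    have "\<bar>(G ^^ Suc n) x\<bar> < r"
      using shrinks[of n "G x"] small[OF that] by (simp add: funpow_swap1)
    from assms(15)[OF this] show ?thesis
      by (simp add: q_def)
  qed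

  interpret cascade G q N \<kappa> \<delta> M a
    by unfold_locales
      (use G_cont contracts \<kappa> G_shift q_cont q_periodic q_filter \<delta> M q_near_0 a q_pos
        in \<open>auto simp: q_def simp del: funpow.simps\<close>)

  have orbit: "cmod (u (cis (2 * pi * backward_orbit \<phi> x (Suc n)))) = q ((G ^^ Suc n) x)" for x n
    unfolding backward_orbit_eq q_def ..
  have conv: "convergent_prod (\<lambda>n. cmod (u (cis (2 * pi * backward_orbit \<phi> x (Suc n)))))" for x
    unfolding orbit by (rule convergent)
  have modulus: "scaling_function \<phi> (\<lambda>z. cmod (u z)) = limit_prod"
    unfolding scaling_function_def orbit limit_prod_def ..
  \<comment> \<open>Convergence of the moduli does not control the arguments, hence the premise on the complex
    product.\<close>
  have modulus_complex: "cmod (scaling_function \<phi> u x) = limit_prod x"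
    if "convergent_prod (\<lambda>n. u (cis (2 * pi * backward_orbit \<phi> x (Suc n))))" for x
    using has_prod_unique[OF has_prod_norm[OF convergent_prod_has_prod[OF that]]]
    unfolding orbit scaling_function_def limit_prod_def by simp

  show ?thesis
    unfolding Let_def
  proof (intro conjI impI allI ballI)
    show "convergent_prod (\<lambda>n. cmod (u (cis (2 * pi * backward_orbit \<phi> x (Suc n)))))" for x
      by (rule conv)
    show "square_integrable (scaling_function \<phi> (\<lambda>z. cmod (u z)))"
      unfolding modulus square_integrable_def
      using limit_measurable limit_square_integrable by simp
    show "norm_L2 (scaling_function \<phi> (\<lambda>z. cmod (u z))) = 1"
      unfolding modulus norm_L2_def by (simp add: limit_unit_norm)
    show "((\<lambda>j::int. (scaling_function \<phi> (\<lambda>z. cmod (u z)) (x + of_int j))\<^sup>2) has_sum 1) UNIV" for x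
      unfolding modulus by (rule limit_periodization)
  next
    assume conv_u: "\<forall>x. convergent_prod (\<lambda>n. u (cis (2 * pi * backward_orbit \<phi> x (Suc n))))"
    have norm_eq: "cmod (scaling_function \<phi> u x) = limit_prod x" for x
      using modulus_complex conv_u by blast
    show "scaling_function \<phi> u x = (\<Prod>n. m (cis (2 * pi * backward_orbit \<phi> x (Suc n))) /
        of_real (sqrt (\<phi> (backward_orbit \<phi> x (Suc n)))))" for x
      unfolding scaling_function_def u ..
    show "square_integrable (scaling_function \<phi> u)"
      unfolding square_integrable_def norm_eq
      using scaling_function_measurable[OF u_cont] conv_u limit_square_integrable by simp
    show "norm_L2 (scaling_function \<phi> u) = 1"
      unfolding norm_L2_def norm_eq by (simp add: limit_unit_norm)
    show "((\<lambda>j::int. (cmod (scaling_function \<phi> u (x + of_int j)))\<^sup>2) has_sum 1) UNIV" for x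
      unfolding norm_eq by (rule limit_periodization)
  qed
qed


end
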